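(* Let $(X,O,\mathcal{M})$ be a marginal scenario and $H[X]$ its associated contextuality scenario. The formula $$p(C,s)=P_C(s)\qquad (C\in\mathcal{M},\ s\in O^C)$$ defines a linear bijection between empirical models $P$ on $X$ and probabilistic models $p$ on $H[X]$ (i.e. $P$ is an empirical model on $X$ if and only if the corresponding $p$ is a probabilistic model on $H[X]$).
   Context: A marginal scenario $(X,O,\mathcal{M})$, denoted simply $X$, consists of a finite set $X$ of observables, a finite set $O$ of outcomes, and a family $\mathcal{M}\subseteq2^X$ of measurement contexts such that $\bigcup_{C\in\mathcal{M}}C=X$ and $\mathcal{M}$ is an antichain ($C\subseteq C'$ with $C,C'\in\mathcal{M}$ implies $C=C'$). For $X=\emptyset$ one takes $\mathcal{M}=\{\emptyset\}$. For $A\in X$, the induced marginal scenario $X\{A\}$ has observables $\{A'\in X: A'\neq A,\ \exists C\in\mathcal{M}\text{ with }\{A,A'\}\subseteq C\}$, the same outcomes $O$, and measurement contexts $C\setminus\{A\}$ for those $C\in\mathcal{M}$ with $A\in C$. Measurement protocols on $X$ are defined recursively; $\mathrm{MP}(X)$ is the set of them: if $X=\emptyset$ the only protocol is $T=\emptyset$; otherwise a protocol is a pair $T=(A,f)$ with $A\in X$ and $f:O\to\mathrm{MP}(X\{A\})$. The outcome set is $\mathrm{Out}(\emptyset)=\{\ast\}$ and $\mathrm{Out}((A,f))=\{(A,a,\alpha'):a\in O,\ \alpha'\in\mathrm{Out}(f(a))\}$. To each outcome $\alpha$ one associates a context $C(\alpha)\in\mathcal{M}$ and an assignment $s(\alpha)\in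 O^{C(\alpha)}$ recursively: $C(\ast)=\emptyset$ with the empty assignment; for $\alpha=(A,a,\alpha')$, $C(\alpha)=\{A\}\cup C(\alpha')$, and $s(\alpha)$ maps $A\mapsto a$ and agrees with $s(\alpha')$ on $C(\alpha')$. $H[X]$ is the hypergraph with vertices $V(H[X])=\{(C,s):C\in\mathcal{M},\ s\in O^C\}$ and edges $e_T=\{(C(\alpha),s(\alpha)):\alpha\in\mathrm{Out}(T)\}$ for $T\in\mathrm{MP}(X)$. A probabilistic model on a hypergraph $H$ is a map $p:V(H)\to[0,1]$ with $\sum_{v\in e}p(v)=1$ for all $e\in E(H)$. An empirical model $P$ on $X$ is a family of probability distributions $P_C$ on $O^C$, one for each $C\in\mathcal{M}$, such that for all $C,C'\in\mathcal{M}$ the marginal distributions of $P_C$ and $P_{C'}$ on $O^{C\cap C'}$ coincide. *)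

theory Defs
  imports Complex_Main "HOL-Library.FuncSet" "HOL-Library.Function_Algebras"
begin

record ('a, 'o) scenario =
  observables :: "'a set"
  outcomes :: "'o set"
  contexts :: "'a set set"

definition marginal_scenario :: "('a, 'o) scenario \<Rightarrow> bool" where
  "marginal_scenario S \<longleftrightarrow>
     finite (observables S) \<and> finite (outcomes S) \<and>
     contexts S \<subseteq> Pow (observables S) \<and>
     \<Union> (contexts S) = observables S \<and>
     (\<forall>C\<in>contexts S. \<forall>C'\<in>contexts S. C \<subseteq> C' \<longrightarrow> C = C') \<and>
     (observables S = {} \<longrightarrow> contexts S = {{}})"

text \<open>\<open>O\<^sup>C\<close>: functions on \<open>C\<close> are represented by their extension with value \<open>undefined\<close>
  outside \<open>C\<close>, as usual for \<^const>\<open>PiE\<close>.\<close>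

definition assignments :: "('a, 'o) scenario \<Rightarrow> 'a set \<Rightarrow> ('a \<Rightarrow> 'o) set" where
  "assignments S C = C \<rightarrow>\<^sub>E outcomes S"

definition induced :: "('a, 'o) scenario \<Rightarrow> 'a \<Rightarrow> ('a, 'o) scenario" where
  "induced S A =
     \<lparr>observables = {A' \<in> observables S. A' \<noteq> A \<and> (\<exists>C\<in>contexts S. {A, A'} \<subseteq> C)},
      outcomes = outcomes S,
      contexts = {C - {A} | C. C \<in> contexts S \<and> A \<in> C}\<rparr>"

text \<open>Protocol trees; which of them are measurement protocols on a given scenario is fixed by
  \<open>is_protocol\<close> below.\<close>

datatype ('a, 'o) protocol = Stop | Measure 'a "'o \<Rightarrow> ('a, 'o) protocol"

text \<open>The condition \<open>f \<in> extensional (outcomes S)\<close> makes \<open>f\<close> represent a function with domain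
  exactly the outcome set.\<close>

inductive is_protocol :: "('a, 'o) scenario \<Rightarrow> ('a, 'o) protocol \<Rightarrow> bool" where
  Stop: "observables S = {} \<Longrightarrow> is_protocol S Stop"
| Measure: "\<lbrakk>A \<in> observables S; f \<in> extensional (outcomes S);
             \<forall>a\<in>outcomes S. is_protocol (induced S A) (f a)\<rbrakk>
            \<Longrightarrow> is_protocol S (Measure A f)"

definition MP :: "('a, 'o) scenario \<Rightarrow> ('a, 'o) protocol set" where
  "MP S = {T. is_protocol S T}"

datatype ('a, 'o) outcome = Star | Step 'a 'o "('a, 'o) outcome"

primrec Out :: "'o set \<Rightarrow> ('a, 'o) protocol \<Rightarrow> ('a, 'o) outcome set" where
  "Out Os Stop = {Star}"
| "Out Os (Measure A f) = {Step A a \<alpha> | a \<alpha>. a \<in> Os \<and> \<alpha> \<in> Out Os (f a)}"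

primrec outcome_context :: "('a, 'o) outcome \<Rightarrow> 'a set" where
  "outcome_context Star = {}"
| "outcome_context (Step A a \<alpha>) = {A} \<union> outcome_context \<alpha>"

primrec outcome_assignment :: "('a, 'o) outcome \<Rightarrow> 'a \<Rightarrow> 'o" where
  "outcome_assignment Star = (\<lambda>_. undefined)"
| "outcome_assignment (Step A a \<alpha>) = (outcome_assignment \<alpha>)(A := a)"

record 'v hypergraph =
  vertices :: "'v set"
  hyperedges :: "'v set set"

definition protocol_edge ::
    "('a, 'o) scenario \<Rightarrow> ('a, 'o) protocol \<Rightarrow> ('a set \<times> ('a \<Rightarrow> 'o)) set" where
  "protocol_edge S T =
     {(outcome_context \<alpha>, outcome_assignment \<alpha>) | \<alpha>. \<alpha> \<in> Out (outcomes S) T}"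

definition scenario_hypergraph ::
    "('a, 'o) scenario \<Rightarrow> ('a set \<times> ('a \<Rightarrow> 'o)) hypergraph" where
  "scenario_hypergraph S =
     \<lparr>vertices = {(C, s). C \<in> contexts S \<and> s \<in> assignments S C},
      hyperedges = {protocol_edge S T | T. T \<in> MP S}\<rparr>"

definition is_probabilistic_model :: "'v hypergraph \<Rightarrow> ('v \<Rightarrow> real) \<Rightarrow> bool" where
  "is_probabilistic_model H p \<longleftrightarrow>
     p \<in> vertices H \<rightarrow> {0..1} \<and> (\<forall>e\<in>hyperedges H. (\<Sum>v\<in>e. p v) = 1)"

definition marginal ::
    "('a, 'o) scenario \<Rightarrow> ('a set \<Rightarrow> ('a \<Rightarrow> 'o) \<Rightarrow> real) \<Rightarrow> 'a set \<Rightarrow> 'a set \<Rightarrow> ('a \<Rightarrow> 'o) \<Rightarrow> real" where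
  "marginal S P C D t = (\<Sum>s\<in>{s \<in> assignments S C. restrict s D = t}. P C s)"

definition is_empirical_model ::
    "('a, 'o) scenario \<Rightarrow> ('a set \<Rightarrow> ('a \<Rightarrow> 'o) \<Rightarrow> real) \<Rightarrow> bool" where
  "is_empirical_model S P \<longleftrightarrow>
     (\<forall>C\<in>contexts S. (\<forall>s\<in>assignments S C. 0 \<le> P C s) \<and> (\<Sum>s\<in>assignments S C. P C s) = 1) \<and>
     (\<forall>C\<in>contexts S. \<forall>C'\<in>contexts S. \<forall>t\<in>assignments S (C \<inter> C').
        marginal S P C (C \<inter> C') t = marginal S P C' (C \<inter> C') t)"

text \<open>The predicates \<open>is_probabilistic_model\<close> and \<open>is_empirical_model\<close> constrain their arguments
  only on the intended domains. The sets below contain exactly one representative of each model,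
  namely the one that vanishes outside the domain; unlike extension by \<open>undefined\<close>, extension by
  zero identifies functions on the domain with a linear subspace.\<close>

definition probabilistic_models :: "'v hypergraph \<Rightarrow> ('v \<Rightarrow> real) set" where
  "probabilistic_models H =
     {p. is_probabilistic_model H p \<and> (\<forall>v. v \<notin> vertices H \<longrightarrow> p v = 0)}"

definition empirical_models ::
    "('a, 'o) scenario \<Rightarrow> ('a set \<Rightarrow> ('a \<Rightarrow> 'o) \<Rightarrow> real) set" where
  "empirical_models S =
     {P. is_empirical_model S P \<and>
         (\<forall>C s. \<not> (C \<in> contexts S \<and> s \<in> assignments S C) \<longrightarrow> P C s = 0)}"

end

theory Submission
  imports Defs
begin

text \<open>For one direction, conditioning a compatible family on the outcome \<open>a\<close> of the first
  measurement \<open>A\<close>, without renormalising, gives a compatible family on the induced scenario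
  whose total mass is the weight of \<open>a\<close>; induction on the protocol then shows that every edge
  carries the common total mass of the contexts. For the other direction, measuring a context \<open>C\<close>
  in a fixed order gives the edge of all assignments on \<open>C\<close>, and measuring \<open>C \<inter> C'\<close> first and
  continuing to \<open>C'\<close> if the outcome is \<open>t\<close> and to \<open>C\<close> otherwise gives an edge that differs from
  it by exchanging the fibre over \<open>t\<close> in \<open>C\<close> for that in \<open>C'\<close>. As both edges have mass one, the
  two marginals agree at \<open>t\<close>.\<close>

section \<open>Contexts and assignments of a scenario and of its induced scenarios\<close>

lemma outcomes_induced [simp]: "outcomes (induced S A) = outcomes S"
  by (simp add: induced_def)

lemma assignments_induced [simp]: "assignments (induced S A) C = assignments S C"
  by (simp add: assignments_def)

lemma contexts_induced: "contexts (induced S A) = {C - {A} | C. C \<in> contexts S \<and> A \<in> C}"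
  by (simp add: induced_def)

lemma Diff_mem_contexts_induced:
  "C \<in> contexts S \<Longrightarrow> A \<in> C \<Longrightarrow> C - {A} \<in> contexts (induced S A)"
  by (auto simp: contexts_induced)

lemma insert_mem_contexts:
  assumes "K \<in> contexts (induced S A)"
  shows "insert A K \<in> contexts S" "A \<notin> K"
  using assms by (auto simp: contexts_induced insert_absorb)

lemma marginal_scenarioD:
  assumes "marginal_scenario S"
  shows "finite (observables S)" "finite (outcomes S)"
    and "C \<in> contexts S \<Longrightarrow> C \<subseteq> observables S"
    and "C \<in> contexts S \<Longrightarrow> C' \<in> contexts S \<Longrightarrow> C \<subseteq> C' \<Longrightarrow> C = C'"
    and "\<Union> (contexts S) = observables S"
    and "observables S = {} \<Longrightarrow> contexts S = {{}}"
proof -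
  note S = assms[unfolded marginal_scenario_def]
  show "finite (observables S)" "finite (outcomes S)" "\<Union> (contexts S) = observables S"
    "observables S = {} \<Longrightarrow> contexts S = {{}}"
    using S by iprover+
  show "C \<subseteq> observables S" if "C \<in> contexts S"
    using \<open>\<Union> (contexts S) = observables S\<close> that by blast
  have "\<forall>C\<in>contexts S. \<forall>C'\<in>contexts S. C \<subseteq> C' \<longrightarrow> C = C'"
    using S by iprover
  thus "C = C'" if "C \<in> contexts S" "C' \<in> contexts S" "C \<subseteq> C'"
    using that by blast
qed

lemma finite_context: "marginal_scenario S \<Longrightarrow> C \<in> contexts S \<Longrightarrow> finite C"
  by (rule finite_subset[OF marginal_scenarioD(3,1)])

lemma finite_assignments:
  "marginal_scenario S \<Longrightarrow> C \<in> contexts S \<Longrightarrow> finite (assignments S C)"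
  unfolding assignments_def by (rule finite_PiE[OF finite_context marginal_scenarioD(2)])

lemma observable_in_context:
  assumes "marginal_scenario S" "A \<in> observables S"
  obtains C where "C \<in> contexts S" "A \<in> C"
  using marginal_scenarioD(5)[OF assms(1)] assms(2) by blast

text \<open>The empty set lies below every context, so by the antichain condition it can be a
  context only if it is the sole one. This decides when a protocol may stop.\<close>

lemma context_empty_iff:
  assumes S: "marginal_scenario S" and C: "C \<in> contexts S"
  shows "C = {} \<longleftrightarrow> observables S = {}"
proof
  assume "C = {}"
  hence "C' = {}" if "C' \<in> contexts S" for C'
    using marginal_scenarioD(4)[OF S C that] by simp
  thus "observables S = {}" using marginal_scenarioD(5)[OF S] by blast
next
  assume "observables S = {}"
  thus "C = {}" using marginal_scenarioD(3)[OF S C] by simp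
qed

text \<open>Putting \<open>A\<close> back into two comparable contexts gives comparable contexts of
  \<open>S\<close>, so the antichain condition is inherited.\<close>

lemma marginal_scenario_induced:
  assumes S: "marginal_scenario S" and A: "A \<in> observables S"
  shows "marginal_scenario (induced S A)"
proof -
  note sub = marginal_scenarioD(3)[OF S] and anti = marginal_scenarioD(4)[OF S]
  obtain C0 where C0: "C0 \<in> contexts S" "A \<in> C0"
    using observable_in_context[OF S A] .
  have un: "\<Union> (contexts (induced S A)) = observables (induced S A)"
    using sub by (auto simp: induced_def)
  have "C = C'" if "C \<in> contexts (induced S A)" "C' \<in> contexts (induced S A)" "C \<subseteq> C'" for C C'
  proof -
    have "insert A C = insert A C'"
      using insert_mem_contexts that by (metis anti insert_mono)
    thus ?thesis using insert_mem_contexts(2) that by (metis insert_ident)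
  qed
  \<comment> \<open>All contexts are empty because their union is; \<open>C0 - {A}\<close> shows
    that there is at least one.\<close>
  moreover have "contexts (induced S A) = {{}}" if "observables (induced S A) = {}"
    using un that Diff_mem_contexts_induced[OF C0] by auto
  moreover have "finite (observables (induced S A))" "finite (outcomes S)"
    using marginal_scenarioD(1,2)[OF S] by (auto simp: induced_def)
  ultimately show ?thesis
    using un unfolding marginal_scenario_def by (intro conjI ballI impI) auto
qed

text \<open>For functions extended by \<open>undefined\<close>, resetting the value at
  \<open>A\<close> is restriction to \<open>K - {A}\<close>. This splits an assignment on
  \<open>K\<close> into its value at \<open>A\<close> and the rest, which drives all recursions
  below.\<close>

lemma upd_mem_assignments_iff:
  assumes "A \<in> K"
  shows "s \<in> assignments S K \<longleftrightarrow>
    s A \<in> outcomes S \<and> s(A := undefined) \<in> assignments S (K - {A})"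
proof -
  have "insert A (K - {A}) = K" using assms by blast
  thus ?thesis
    by (auto simp: assignments_def PiE_iff extensional_def split: if_splits)
qed

lemma assignments_outside: "s \<in> assignments S K \<Longrightarrow> A \<notin> K \<Longrightarrow> s(A := undefined) = s"
  by (metis PiE_arb assignments_def fun_upd_triv)

section \<open>Edges of protocols\<close>

lemma protocol_edge_Stop: "protocol_edge S Stop = {({}, \<lambda>_. undefined)}"
  by (auto simp: protocol_edge_def)

lemma protocol_edge_Measure:
  "protocol_edge S (Measure A f) =
    (\<Union>a\<in>outcomes S. (\<lambda>(C, s). (insert A C, s(A := a))) ` protocol_edge (induced S A) (f a))"
proof -
  have "protocol_edge S (Measure A f) = (\<Union>a\<in>outcomes S.
      (\<lambda>\<alpha>. (outcome_context (Step A a \<alpha>), outcome_assignment (Step A a \<alpha>))) ` Out (outcomes S) (f a))"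
    unfolding protocol_edge_def Out.simps by blast
  moreover have "protocol_edge (induced S A) T =
      (\<lambda>\<alpha>. (outcome_context \<alpha>, outcome_assignment \<alpha>)) ` Out (outcomes S) T" for T
    unfolding protocol_edge_def outcomes_induced by blast
  ultimately show ?thesis by (simp add: image_image)
qed

text \<open>This is the well-definedness of \<open>C(\<alpha>)\<close> and
  \<open>s(\<alpha>)\<close>: contexts of the induced scenario become contexts of \<open>S\<close>
  when \<open>A\<close> is put back, and a protocol stops only where the empty context is the only
  one.\<close>

lemma protocol_edge_subset:
  assumes "is_protocol S T" "marginal_scenario S"
  shows "protocol_edge S T \<subseteq> (SIGMA C:contexts S. assignments S C)"
  using assms
proof (induction rule: is_protocol.induct)
  case (Stop S)
  thus ?case using marginal_scenarioD(6)[of S] by (auto simp: protocol_edge_Stop assignments_def)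
next
  case (Measure A S f)
  have "insert A C \<in> contexts S \<and> s(A := a) \<in> assignments S (insert A C)"
    if a: "a \<in> outcomes S" and Cs: "(C, s) \<in> protocol_edge (induced S A) (f a)" for a C s
  proof -
    have "C \<in> contexts (induced S A)" and s: "s \<in> assignments S C"
      using Measure.IH a Cs marginal_scenario_induced[OF Measure.prems Measure.hyps(1)] by auto
    hence "insert A C \<in> contexts S" "A \<notin> C" by (auto dest: insert_mem_contexts)
    thus ?thesis
      using a s assignments_outside[OF s \<open>A \<notin> C\<close>]
      by (simp add: upd_mem_assignments_iff[of A "insert A C"])
  qed
  thus ?case by (auto simp: protocol_edge_Measure)
qed

text \<open>No context of \<open>induced S A\<close> contains \<open>A\<close>, so a vertex of the
  edge determines the first outcome, namely \<open>s A\<close>, and its tail arises by deleting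
  \<open>A\<close>. Edges can thus be computed by a pointwise test instead of a union of
  images.\<close>

lemma mem_protocol_edge_Measure:
  assumes S: "marginal_scenario S" and T: "is_protocol S (Measure A f)"
  shows "(K, s) \<in> protocol_edge S (Measure A f) \<longleftrightarrow>
    A \<in> K \<and> s A \<in> outcomes S \<and>
    (K - {A}, s(A := undefined)) \<in> protocol_edge (induced S A) (f (s A))"
    (is "?L \<longleftrightarrow> ?R")
proof
  assume ?L
  then obtain a C u where a: "a \<in> outcomes S"
    and Cu: "(C, u) \<in> protocol_edge (induced S A) (f a)"
    and K: "K = insert A C" and s: "s = u(A := a)"
    by (auto simp: protocol_edge_Measure)
  from T have A: "A \<in> observables S" and f: "is_protocol (induced S A) (f a)"
    using a by (auto elim: is_protocol.cases)
  have C: "C \<in> contexts (induced S A)" and u: "u \<in> assignments S C"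
    using protocol_edge_subset[OF f marginal_scenario_induced[OF S A]] Cu by auto
  have "A \<notin> C" using insert_mem_contexts(2)[OF C] .
  moreover from this have "u(A := undefined) = u" by (rule assignments_outside[OF u])
  ultimately show ?R using a Cu by (simp add: K s)
next
  assume R: ?R
  let ?h = "\<lambda>(C, u). (insert A C, u(A := s A))"
  from R have "?h (K - {A}, s(A := undefined)) \<in> ?h ` protocol_edge (induced S A) (f (s A))"
    by (intro imageI) blast
  moreover have "?h (K - {A}, s(A := undefined)) = (K, s)" using R by auto
  ultimately have "(K, s) \<in> ?h ` protocol_edge (induced S A) (f (s A))" by (simp only:)
  thus ?L using R unfolding protocol_edge_Measure by (intro UN_I[of "s A"]) simp_all
qed

section \<open>Protocols with prescribed edges\<close>

lemma is_protocol_Measure_restrict: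
  assumes "A \<in> observables S" "\<And>a. a \<in> outcomes S \<Longrightarrow> is_protocol (induced S A) (f a)"
  shows "is_protocol S (Measure A (restrict f (outcomes S)))"
  using assms by (auto intro!: is_protocol.Measure)

text \<open>The elements of \<open>C\<close> are measured one after another, whatever the earlier
  outcomes. What remains of \<open>C\<close> is a context of the induced scenario at each
  stage.\<close>

lemma protocol_measuring_context:
  assumes "marginal_scenario S" "C \<in> contexts S"
  shows "\<exists>T. is_protocol S T \<and> protocol_edge S T = {C} \<times> assignments S C"
proof -
  have "finite C" using assms finite_context by blast
  thus ?thesis using assms
  proof (induction C arbitrary: S rule: finite_induct)
    case empty
    \<comment> \<open>Once all of \<open>C\<close> is used up, the empty set is a context, so no
      observable is left and stopping is legitimate.\<close>
    hence "is_protocol S Stop"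
      using context_empty_iff[OF empty] by (auto intro: is_protocol.Stop)
    thus ?case by (intro exI[of _ Stop]) (auto simp: protocol_edge_Stop assignments_def)
  next
    case (insert A C)
    hence A: "A \<in> observables S" using marginal_scenarioD(3)[OF insert.prems] by simp
    have C: "C \<in> contexts (induced S A)"
      using Diff_mem_contexts_induced[OF insert.prems(2), of A] insert.hyps by simp
    obtain T where T: "is_protocol (induced S A) T"
      "protocol_edge (induced S A) T = {C} \<times> assignments S C"
      using insert.IH[OF marginal_scenario_induced[OF insert.prems(1) A] C] by auto
    define T' where "T' = Measure A (\<lambda>a\<in>outcomes S. T)"
    have T': "is_protocol S T'"
      unfolding T'_def by (intro is_protocol_Measure_restrict A T)
    have "(K, s) \<in> protocol_edge S T' \<longleftrightarrow> (K, s) \<in> {insert A C} \<times> assignments S (insert A C)" for K s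
    proof -
      have "A \<in> K \<and> K - {A} = C \<longleftrightarrow> K = insert A C" using insert.hyps by blast
      moreover have "s \<in> assignments S (insert A C) \<longleftrightarrow>
          s A \<in> outcomes S \<and> s(A := undefined) \<in> assignments S C"
        using insert.hyps upd_mem_assignments_iff[of A "insert A C" s S] by simp
      ultimately show ?thesis
        using mem_protocol_edge_Measure[OF insert.prems(1) T'[unfolded T'_def]]
        by (auto simp: T'_def T(2))
    qed
    hence "protocol_edge S T' = {insert A C} \<times> assignments S (insert A C)"
      by (intro set_eqI) (simp only: split_paired_all)
    thus ?case using T' by blast
  qed
qed

text \<open>The elements of \<open>D\<close> are measured one at a time as long as the outcomes
  follow \<open>t\<close>; the first deviation commits the protocol to \<open>C\<close>. If some
  value of \<open>t\<close> on \<open>D\<close> is not an outcome, \<open>C'\<close> is simply never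
  reached.\<close>

lemma protocol_branching:
  assumes "marginal_scenario S" "C \<in> contexts S" "C' \<in> contexts S"
    and "D \<subseteq> C \<inter> C'" "t \<in> extensional D"
  shows "\<exists>T. is_protocol S T \<and> (\<forall>K s. (K, s) \<in> protocol_edge S T \<longleftrightarrow>
    K = (if restrict s D = t then C' else C) \<and> s \<in> assignments S K)"
proof -
  have "finite D" using assms finite_context by (metis finite_Int finite_subset)
  thus ?thesis using assms
  proof (induction D arbitrary: S C C' t rule: finite_induct)
    case empty
    \<comment> \<open>Over the empty set every \<open>s\<close> restricts to \<open>t\<close>, so
      the test always succeeds and \<open>C'\<close> is measured.\<close>
    hence "t = (\<lambda>_. undefined)" by (auto simp: extensional_def)
    moreover obtain T where "is_protocol S T" "protocol_edge S T = {C'} \<times> assignments S C'"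
      using protocol_measuring_context[OF empty(1) empty(3)] by blast
    ultimately show ?case by (intro exI[of _ T]) (auto simp: restrict_def)
  next
    case (insert A D)
    have A: "A \<in> observables S" "A \<in> C" "A \<in> C'"
      using insert.prems marginal_scenarioD(3)[OF insert.prems(1)] by auto
    note S' = marginal_scenario_induced[OF insert.prems(1) A(1)]
    note CA = Diff_mem_contexts_induced[OF insert.prems(2) A(2)]
      and CA' = Diff_mem_contexts_induced[OF insert.prems(3) A(3)]
    obtain T where T: "is_protocol (induced S A) T"
      "protocol_edge (induced S A) T = {C - {A}} \<times> assignments S (C - {A})"
      using protocol_measuring_context[OF S' CA] by auto
    have D: "D \<subseteq> (C - {A}) \<inter> (C' - {A})" and t: "t(A := undefined) \<in> extensional D"
      using insert.prems(4,5) insert.hyps(2) by (auto simp: extensional_def)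
    obtain U where U: "is_protocol (induced S A) U"
      "\<And>K s. (K, s) \<in> protocol_edge (induced S A) U \<longleftrightarrow>
        K = (if restrict s D = t(A := undefined) then C' - {A} else C - {A})
        \<and> s \<in> assignments S K"
      using insert.IH[OF S' CA CA' D t] unfolding assignments_induced
      by (elim exE conjE) (rule that, assumption, blast)
    \<comment> \<open>\<open>U\<close> goes on comparing with the remaining values of
      \<open>t\<close>, whereas \<open>T\<close> ignores them and finishes \<open>C\<close>.\<close>
    define T' where "T' = Measure A (\<lambda>a\<in>outcomes S. if a = t A then U else T)"
    have T': "is_protocol S T'"
      unfolding T'_def by (intro is_protocol_Measure_restrict A) (auto simp: T(1) U(1))
    have "(K, s) \<in> protocol_edge S T' \<longleftrightarrow>
      K = (if restrict s (insert A D) = t then C' else C) \<and> s \<in> assignments S K" for K s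
    proof -
      have r: "restrict s (insert A D) = t \<longleftrightarrow>
          s A = t A \<and> restrict (s(A := undefined)) D = t(A := undefined)"
        using insert.hyps by (auto simp: fun_eq_iff restrict_def)
      \<comment> \<open>Both \<open>C\<close> and \<open>C'\<close> contain \<open>A\<close>, so
        they can be compared with \<open>K\<close> after \<open>A\<close> is removed.\<close>
      have K: "A \<in> K \<and> K - {A} = B - {A} \<longleftrightarrow> K = B" if "A \<in> B" for B
        using that by blast
      have "(K, s) \<in> protocol_edge S T' \<longleftrightarrow> A \<in> K \<and> s A \<in> outcomes S \<and>
          K - {A} = (if restrict s (insert A D) = t then C' - {A} else C - {A}) \<and>
          s(A := undefined) \<in> assignments S (K - {A})"
        using mem_protocol_edge_Measure[OF insert.prems(1) T'[unfolded T'_def]]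
        by (auto simp: T'_def T(2) U(2) r)
      also have "\<dots> \<longleftrightarrow> A \<in> K \<and> K - {A} = (if restrict s (insert A D) = t then C' else C) - {A}
          \<and> s \<in> assignments S K"
        using upd_mem_assignments_iff[of A K s S] by auto
      also have "\<dots> \<longleftrightarrow> K = (if restrict s (insert A D) = t then C' else C) \<and> s \<in> assignments S K"
        using K[of "if restrict s (insert A D) = t then C' else C"] A by auto
      finally show ?thesis .
    qed
    thus ?case using T' by blast
  qed
qed

section \<open>Marginals and conditioning on an outcome\<close>

lemma marginal_empty: "marginal S P C {} (\<lambda>_. undefined) = (\<Sum>s\<in>assignments S C. P C s)"
  by (simp add: marginal_def restrict_def)

text \<open>The sum over the fibre of \<open>t\<close> is grouped by restriction to the intermediate
  set \<open>E\<close>.\<close>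

lemma marginal_marginal:
  assumes "finite (assignments S C)" "D \<subseteq> E" "E \<subseteq> C" "t \<in> assignments S D"
  shows "marginal S P C D t =
    (\<Sum>u\<in>{u \<in> assignments S E. restrict u D = t}. marginal S P C E u)"
proof -
  let ?U = "{u \<in> assignments S E. restrict u D = t}"
  let ?B = "{s \<in> assignments S C. restrict s D = t}"
  have DE: "restrict (restrict s E) D = restrict s D" for s :: "'a \<Rightarrow> 'b"
    using assms(2) by (auto simp: restrict_def fun_eq_iff)
  have im: "(\<lambda>s. restrict s E) ` assignments S C \<subseteq> assignments S E"
    using assms(3) by (auto simp: assignments_def PiE_iff)
  \<comment> \<open>An arbitrary outcome \<open>x\<close> fills in the values on
    \<open>C - E\<close>. Surjectivity of restriction transfers finiteness from \<open>C\<close> to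
    \<open>E\<close>.\<close>
  have ext: "u \<in> (\<lambda>s. restrict s E) ` assignments S C"
    if "u \<in> assignments S E" "outcomes S \<noteq> {}" for u
  proof -
    obtain x where "x \<in> outcomes S" using \<open>outcomes S \<noteq> {}\<close> by blast
    hence "restrict (\<lambda>a. if a \<in> E then u a else x) C \<in> assignments S C"
      using that by (auto simp: assignments_def PiE_iff)
    moreover have "u = restrict (restrict (\<lambda>a. if a \<in> E then u a else x) C) E"
      using that assms(3) by (auto simp: assignments_def fun_eq_iff restrict_def PiE_iff extensional_def)
    ultimately show ?thesis by blast
  qed
  have finU: "finite (assignments S E)"
  proof (cases "outcomes S = {}")
    \<comment> \<open>Without outcomes nothing can be extended, but then there is no assignment on
      \<open>E\<close> unless \<open>E\<close> is empty, and exactly one if it is.\<close>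
    case True
    thus ?thesis by (cases "E = {}") (auto simp: assignments_def PiE_eq_empty_iff)
  next
    case False
    thus ?thesis using ext assms(1) by (meson finite_surj subsetI)
  qed
  have "(\<Sum>u\<in>?U. \<Sum>s\<in>{s \<in> ?B. restrict s E = u}. P C s) = sum (P C) ?B"
    by (rule sum.group) (use assms(1) finU im DE in auto)
  moreover have "{s \<in> ?B. restrict s E = u} = {s \<in> assignments S C. restrict s E = u}" if "u \<in> ?U" for u
    using that DE by auto
  ultimately show ?thesis by (simp add: marginal_def)
qed

definition compatible_marginals ::
    "('a, 'o) scenario \<Rightarrow> ('a set \<Rightarrow> ('a \<Rightarrow> 'o) \<Rightarrow> real) \<Rightarrow> bool" where
  "compatible_marginals S P \<longleftrightarrow>
     (\<forall>C\<in>contexts S. \<forall>C'\<in>contexts S. \<forall>D\<subseteq>C \<inter> C'. \<forall>t\<in>assignments S D.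
        marginal S P C D t = marginal S P C' D t)"

text \<open>Agreement on the full intersection passes to a smaller \<open>D\<close> by marginalising
  in two stages.\<close>

lemma empirical_model_compatible:
  assumes "marginal_scenario S" "is_empirical_model S P"
  shows "compatible_marginals S P"
  unfolding compatible_marginals_def
proof (intro ballI allI impI)
  fix C C' D t
  assume C: "C \<in> contexts S" "C' \<in> contexts S" and D: "D \<subseteq> C \<inter> C'" "t \<in> assignments S D"
  have "marginal S P C (C \<inter> C') u = marginal S P C' (C \<inter> C') u"
    if "u \<in> assignments S (C \<inter> C')" for u
    using assms(2) C that by (simp add: is_empirical_model_def)
  thus "marginal S P C D t = marginal S P C' D t"
    using marginal_marginal[OF finite_assignments[OF assms(1) C(1)] D(1) _ D(2)]
      marginal_marginal[OF finite_assignments[OF assms(1) C(2)] D(1) _ D(2)]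
    by simp
qed

text \<open>The family on the left is \<open>P\<close> conditioned on the outcome \<open>a\<close>
  of \<open>A\<close>, without renormalisation. Setting the value at \<open>A\<close> to
  \<open>a\<close> is a bijection between the two fibres summed over.\<close>

lemma marginal_induced:
  assumes "A \<notin> K" "D \<subseteq> K" "t \<in> extensional D" "a \<in> outcomes S"
  shows "marginal (induced S A) (\<lambda>C s. P (insert A C) (s(A := a))) K D t =
    marginal S P (insert A K) (insert A D) (t(A := a))"
proof -
  have A: "A \<notin> D" "t A = undefined" using assms by (auto simp: extensional_def)
  have r: "restrict s (insert A D) = t(A := a) \<longleftrightarrow> s A = a \<and> restrict (s(A := undefined)) D = t" for s
    using A by (auto simp: fun_eq_iff restrict_def)
  have m: "s \<in> assignments S (insert A K) \<longleftrightarrow>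
      s A \<in> outcomes S \<and> s(A := undefined) \<in> assignments S K" for s
    using upd_mem_assignments_iff[of A "insert A K" s S] assms(1) by simp
  show ?thesis
    unfolding marginal_def
    by (rule sum.reindex_bij_witness[of _ "\<lambda>s. s(A := undefined)" "\<lambda>s. s(A := a)"])
      (use assms in \<open>auto simp: r m assignments_outside\<close>)
qed

lemma compatible_marginals_induced:
  assumes "compatible_marginals S P" "a \<in> outcomes S"
  shows "compatible_marginals (induced S A) (\<lambda>C s. P (insert A C) (s(A := a)))"
  unfolding compatible_marginals_def
proof (intro ballI allI impI)
  fix C C' D t
  assume C: "C \<in> contexts (induced S A)" "C' \<in> contexts (induced S A)"
    and D: "D \<subseteq> C \<inter> C'" and t: "t \<in> assignments (induced S A) D"
  note A = insert_mem_contexts[OF C(1)] insert_mem_contexts[OF C(2)]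
  have "t(A := a) \<in> assignments S (insert A D)"
    using t assms(2) by (auto simp: assignments_def PiE_iff extensional_def)
  moreover have "insert A D \<subseteq> insert A C \<inter> insert A C'" using D by auto
  ultimately have "marginal S P (insert A C) (insert A D) (t(A := a)) =
      marginal S P (insert A C') (insert A D) (t(A := a))"
    using assms(1)[unfolded compatible_marginals_def] A by blast
  moreover have "t \<in> extensional D" using t by (simp add: assignments_def PiE_iff)
  ultimately show "marginal (induced S A) (\<lambda>C s. P (insert A C) (s(A := a))) C D t =
      marginal (induced S A) (\<lambda>C s. P (insert A C) (s(A := a))) C' D t"
    using D A assms(2) by (simp add: marginal_induced)
qed

section \<open>The mass of an edge\<close>

lemma sum_assignments_split:
  assumes "finite (outcomes S)" "finite (assignments S (insert A K))" "A \<notin> K"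
  shows "(\<Sum>s\<in>assignments S (insert A K). g s) =
    (\<Sum>a\<in>outcomes S. \<Sum>s\<in>assignments S K. g (s(A := a)))"
proof -
  have m: "s \<in> assignments S (insert A K) \<longleftrightarrow>
      s A \<in> outcomes S \<and> s(A := undefined) \<in> assignments S K" for s
    using upd_mem_assignments_iff[of A "insert A K" s S] assms(3) by simp
  have "(\<Sum>a\<in>outcomes S. \<Sum>s\<in>{s \<in> assignments S (insert A K). s A = a}. g s) =
      (\<Sum>s\<in>assignments S (insert A K). g s)"
    by (rule sum.group) (use assms m in auto)
  moreover have "(\<Sum>s\<in>{s \<in> assignments S (insert A K). s A = a}. g s) =
      (\<Sum>s\<in>assignments S K. g (s(A := a)))" if "a \<in> outcomes S" for a
    by (rule sum.reindex_bij_witness[of _ "\<lambda>s. s(A := a)" "\<lambda>s. s(A := undefined)"])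
      (use assms that in \<open>auto simp: m assignments_outside\<close>)
  ultimately show ?thesis by simp
qed

lemma finite_protocol_edge:
  assumes "marginal_scenario S" "is_protocol S T"
  shows "finite (protocol_edge S T)"
proof (rule finite_subset[OF protocol_edge_subset[OF assms(2,1)]])
  have "finite (contexts S)"
    using marginal_scenarioD(1,5)[OF assms(1)] finite_UnionD by metis
  thus "finite (SIGMA C:contexts S. assignments S C)"
    using finite_assignments[OF assms(1)] by blast
qed

text \<open>Branches for distinct outcomes are disjoint, being told apart by the value at
  \<open>A\<close>. Within a branch no vertex is counted twice, since deleting \<open>A\<close>
  recovers the vertex of the induced scenario.\<close>

lemma sum_protocol_edge_Measure:
  assumes S: "marginal_scenario S" and T: "is_protocol S (Measure A f)"
  shows "(\<Sum>v\<in>protocol_edge S (Measure A f). g v) =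
    (\<Sum>a\<in>outcomes S. \<Sum>(C, s)\<in>protocol_edge (induced S A) (f a). g (insert A C, s(A := a)))"
proof -
  let ?h = "\<lambda>a (C, s). (insert A C, s(A := a))"
  let ?E = "\<lambda>a. protocol_edge (induced S A) (f a)"
  from T have A: "A \<in> observables S"
    and f: "\<And>a. a \<in> outcomes S \<Longrightarrow> is_protocol (induced S A) (f a)"
    by (auto elim: is_protocol.cases)
  note S' = marginal_scenario_induced[OF S A]
  have inj: "inj_on (?h a) (?E a)" if a: "a \<in> outcomes S" for a
  proof (rule inj_on_inverseI[where g = "\<lambda>(C, s). (C - {A}, s(A := undefined))"])
    fix v assume "v \<in> ?E a"
    moreover obtain C s where v: "v = (C, s)" by fastforce
    ultimately have C: "C \<in> contexts (induced S A)" and s: "s \<in> assignments S C"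
      using protocol_edge_subset[OF f[OF a] S'] by auto
    have "A \<notin> C" using insert_mem_contexts(2)[OF C] .
    moreover from this have "s(A := undefined) = s" by (rule assignments_outside[OF s])
    ultimately show "(case ?h a v of (C, s) \<Rightarrow> (C - {A}, s(A := undefined))) = v" by (simp add: v)
  qed
  have "(\<Sum>v\<in>protocol_edge S (Measure A f). g v) = (\<Sum>a\<in>outcomes S. \<Sum>v\<in>?h a ` ?E a. g v)"
    unfolding protocol_edge_Measure
  proof (rule sum.UNION_disjoint)
    show "finite (outcomes S)" using marginal_scenarioD(2)[OF S] .
    show "\<forall>a\<in>outcomes S. finite (?h a ` ?E a)" using finite_protocol_edge[OF S'] f by blast
    show "\<forall>a\<in>outcomes S. \<forall>b\<in>outcomes S. a \<noteq> b \<longrightarrow> ?h a ` ?E a \<inter> ?h b ` ?E b = {}"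
      by (auto dest: fun_upd_eqD)
  qed
  also have "\<dots> = (\<Sum>a\<in>outcomes S. \<Sum>v\<in>?E a. g (?h a v))"
    using inj by (simp add: sum.reindex)
  finally show ?thesis by (simp add: case_prod_unfold)
qed

text \<open>The induction keeps \<open>P\<close> and \<open>C\<close> general, because in each
  branch the hypothesis is applied to the family conditioned on the first outcome. The branch masses
  then add up to the mass of a context.\<close>

lemma sum_protocol_edge:
  assumes "is_protocol S T" "marginal_scenario S" "compatible_marginals S P" "C \<in> contexts S"
  shows "(\<Sum>(K, s)\<in>protocol_edge S T. P K s) = (\<Sum>s\<in>assignments S C. P C s)"
  using assms
proof (induction arbitrary: P C rule: is_protocol.induct)
  case (Stop S)
  hence "C = {}" using context_empty_iff[of S C] by simp
  thus ?case by (simp add: protocol_edge_Stop assignments_def)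
next
  case (Measure A S f)
  note S = Measure.prems(1) and A = Measure.hyps(1)
  have T: "is_protocol S (Measure A f)"
    using Measure by (auto intro: is_protocol.Measure)
  \<comment> \<open>The given \<open>C\<close> need not contain \<open>A\<close>, so the mass is
    first computed on a context that does.\<close>
  obtain C0 where C0: "C0 \<in> contexts S" "A \<in> C0"
    using observable_in_context[OF S A] .
  have K: "C0 - {A} \<in> contexts (induced S A)" "insert A (C0 - {A}) = C0"
    using C0 by (auto intro: Diff_mem_contexts_induced)
  have "(\<Sum>(K, s)\<in>protocol_edge S (Measure A f). P K s) = (\<Sum>a\<in>outcomes S.
      \<Sum>(K, s)\<in>protocol_edge (induced S A) (f a). P (insert A K) (s(A := a)))"
    using sum_protocol_edge_Measure[OF S T, of "\<lambda>(K, s). P K s"] by (simp add: case_prod_unfold)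
  also have "\<dots> = (\<Sum>a\<in>outcomes S. \<Sum>s\<in>assignments S (C0 - {A}). P C0 (s(A := a)))"
  proof (rule sum.cong[OF refl])
    fix a assume a: "a \<in> outcomes S"
    with Measure.IH have "\<And>P C. marginal_scenario (induced S A) \<Longrightarrow>
        compatible_marginals (induced S A) P \<Longrightarrow> C \<in> contexts (induced S A) \<Longrightarrow>
        (\<Sum>(K, s)\<in>protocol_edge (induced S A) (f a). P K s) =
        (\<Sum>s\<in>assignments (induced S A) C. P C s)"
      by blast
    from this[OF marginal_scenario_induced[OF S A]
        compatible_marginals_induced[OF Measure.prems(2) a] K(1)]
    show "(\<Sum>(K, s)\<in>protocol_edge (induced S A) (f a). P (insert A K) (s(A := a))) =
        (\<Sum>s\<in>assignments S (C0 - {A}). P C0 (s(A := a)))"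
      by (simp only: K(2) assignments_induced)
  qed
  also have "\<dots> = (\<Sum>s\<in>assignments S C0. P C0 s)"
    using sum_assignments_split[of S A "C0 - {A}" "P C0"] finite_assignments[OF S C0(1)]
      marginal_scenarioD(2)[OF S]
    by (simp only: K(2)) simp
  also have "\<dots> = (\<Sum>s\<in>assignments S C. P C s)"
  proof -
    \<comment> \<open>Compatibility over \<open>D = {}\<close> is equality of total masses, which
      leads from \<open>C0\<close> back to \<open>C\<close>.\<close>
    have "(\<lambda>_. undefined) \<in> assignments S {}" by (simp add: assignments_def)
    hence "marginal S P C0 {} (\<lambda>_. undefined) = marginal S P C {} (\<lambda>_. undefined)"
      using Measure.prems(2)[unfolded compatible_marginals_def] Measure.prems(3) C0(1) by blast
    thus ?thesis by (simp add: marginal_empty)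
  qed
  finally show ?case .
qed

section \<open>The two directions of the correspondence\<close>

lemma empirical_imp_probabilistic:
  assumes S: "marginal_scenario S" and P: "is_empirical_model S P"
    and p: "\<And>C s. C \<in> contexts S \<Longrightarrow> s \<in> assignments S C \<Longrightarrow> p (C, s) = P C s"
  shows "is_probabilistic_model (scenario_hypergraph S) p"
proof -
  \<comment> \<open>The upper bound holds because \<open>P C s\<close> is one term of a nonnegative
    sum equal to one.\<close>
  have "0 \<le> P C s \<and> P C s \<le> 1" if C: "C \<in> contexts S" and s: "s \<in> assignments S C" for C s
    using P C s member_le_sum[of s "assignments S C" "P C"] finite_assignments[OF S C]
    by (auto simp: is_empirical_model_def)
  moreover have "(\<Sum>v\<in>protocol_edge S T. p v) = 1" if T: "is_protocol S T" for T
  proof -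
    \<comment> \<open>A context exists even without observables, by the convention that the empty
      set is then the only one.\<close>
    obtain C where C: "C \<in> contexts S"
      using marginal_scenarioD(5,6)[OF S] by blast
    have "(\<Sum>v\<in>protocol_edge S T. p v) = (\<Sum>(K, s)\<in>protocol_edge S T. P K s)"
      using protocol_edge_subset[OF T S] p by (intro sum.cong) auto
    also have "\<dots> = (\<Sum>s\<in>assignments S C. P C s)"
      using sum_protocol_edge[OF T S empirical_model_compatible[OF S P] C] .
    finally show ?thesis using P C by (simp add: is_empirical_model_def)
  qed
  ultimately show ?thesis
    using p by (auto simp: is_probabilistic_model_def scenario_hypergraph_def MP_def)
qed

lemma probabilistic_imp_empirical:
  assumes S: "marginal_scenario S"
    and prob: "is_probabilistic_model (scenario_hypergraph S) p"
    and p: "\<And>C s. C \<in> contexts S \<Longrightarrow> s \<in> assignments S C \<Longrightarrow> p (C, s) = P C s"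
  shows "is_empirical_model S P"
  unfolding is_empirical_model_def
proof (intro conjI ballI)
  have edge: "(\<Sum>v\<in>protocol_edge S T. p v) = 1" if "is_protocol S T" for T
    using prob that by (auto simp: is_probabilistic_model_def scenario_hypergraph_def MP_def)
  show "0 \<le> P C s" if "C \<in> contexts S" "s \<in> assignments S C" for C s
    using prob p that
    by (force simp: is_probabilistic_model_def scenario_hypergraph_def Pi_iff)
  have fibre: "(\<Sum>v\<in>{C} \<times> B. p v) = (\<Sum>s\<in>B. P C s)"
    if "C \<in> contexts S" "B \<subseteq> assignments S C" for C B
    unfolding sum.cartesian_product' using that p by (auto intro!: sum.cong)
  show total: "(\<Sum>s\<in>assignments S C. P C s) = 1" if C: "C \<in> contexts S" for C
  proof -
    obtain T where "is_protocol S T" "protocol_edge S T = {C} \<times> assignments S C"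
      using protocol_measuring_context[OF S C] by blast
    thus ?thesis using edge[of T] fibre[OF C order_refl] by simp
  qed
  fix C C' t
  assume C: "C \<in> contexts S" "C' \<in> contexts S" and t: "t \<in> assignments S (C \<inter> C')"
  let ?D = "C \<inter> C'"
  let ?B = "{s \<in> assignments S C. restrict s ?D = t}"
  let ?B' = "{s \<in> assignments S C'. restrict s ?D = t}"
  have "t \<in> extensional ?D" using t by (simp add: assignments_def PiE_iff)
  from protocol_branching[OF S C order_refl this] obtain T where T: "is_protocol S T"
    "\<And>K s. (K, s) \<in> protocol_edge S T \<longleftrightarrow>
      K = (if restrict s ?D = t then C' else C) \<and> s \<in> assignments S K"
    by (elim exE conjE) (rule that, assumption, blast)
  \<comment> \<open>Assignments in the fibre over \<open>t\<close> are those on \<open>C'\<close>,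
    all others those on \<open>C\<close>.\<close>
  have "protocol_edge S T = {C} \<times> (assignments S C - ?B) \<union> {C'} \<times> ?B'"
    by (auto simp: T(2) split: if_splits)
  \<comment> \<open>For \<open>C = C'\<close> the two parts are disjoint too, as one is then the
    complement of the other.\<close>
  moreover have "{C} \<times> (assignments S C - ?B) \<inter> {C'} \<times> ?B' = {}" by auto
  moreover have fin: "finite (assignments S C)" "finite (assignments S C')"
    using finite_assignments S C by blast+
  ultimately have "1 = (\<Sum>v\<in>{C} \<times> (assignments S C - ?B). p v) + (\<Sum>v\<in>{C'} \<times> ?B'. p v)"
    using edge[OF T(1)] by (simp add: sum.union_disjoint)
  also have "\<dots> = (\<Sum>s\<in>assignments S C - ?B. P C s) + (\<Sum>s\<in>?B'. P C' s)"
    using C by (subst (1 2) fibre) auto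
  \<comment> \<open>The edge measuring \<open>C\<close> alone has mass one, so the complement is
    traded for the fibre, and equality of the two fibre masses is all that remains.\<close>
  also have "(\<Sum>s\<in>assignments S C - ?B. P C s) = 1 - (\<Sum>s\<in>?B. P C s)"
    using fin total[OF C(1)] by (subst sum_diff) auto
  finally show "marginal S P C ?D t = marginal S P C' ?D t"
    unfolding marginal_def by linarith
qed

theorem theoremD2p1:
  fixes S :: "('a, 'o) scenario"
  assumes "marginal_scenario S"
  shows
    "Vector_Spaces.linear
       (\<lambda>(c::real) (P :: 'a set \<Rightarrow> ('a \<Rightarrow> 'o) \<Rightarrow> real). \<lambda>C s. c * P C s)
       (\<lambda>c p. \<lambda>v. c * p v)
       (\<lambda>P. \<lambda>(C, s). P C s) \<and>
     bij_betw (\<lambda>P. \<lambda>(C, s). P C s)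
       (empirical_models S) (probabilistic_models (scenario_hypergraph S)) \<and>
     (\<forall>P p. (\<forall>C\<in>contexts S. \<forall>s\<in>assignments S C. p (C, s) = P C s) \<longrightarrow>
        (is_empirical_model S P \<longleftrightarrow> is_probabilistic_model (scenario_hypergraph S) p))"
proof (intro conjI allI impI)
  \<comment> \<open>Linearity is that of uncurrying on the full function spaces, since neither set
    of models is itself a subspace.\<close>
  show "Vector_Spaces.linear
       (\<lambda>(c::real) (P :: 'a set \<Rightarrow> ('a \<Rightarrow> 'o) \<Rightarrow> real). \<lambda>C s. c * P C s)
       (\<lambda>c p. \<lambda>v. c * p v)
       (\<lambda>P. \<lambda>(C, s). P C s)"
    by unfold_locales (auto simp: fun_eq_iff algebra_simps)
  show iff: "is_empirical_model S P \<longleftrightarrow> is_probabilistic_model (scenario_hypergraph S) p"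
    if "\<forall>C\<in>contexts S. \<forall>s\<in>assignments S C. p (C, s) = P C s" for P p
    using that empirical_imp_probabilistic[OF assms] probabilistic_imp_empirical[OF assms] by blast
  have vertices: "(C, s) \<in> vertices (scenario_hypergraph S) \<longleftrightarrow>
      C \<in> contexts S \<and> s \<in> assignments S C" for C s
    by (simp add: scenario_hypergraph_def)
  \<comment> \<open>Currying is the inverse, and it turns vanishing off the vertices into vanishing
    off the domain of \<open>P\<close>.\<close>
  show "bij_betw (\<lambda>P. \<lambda>(C, s). P C s)
       (empirical_models S) (probabilistic_models (scenario_hypergraph S))"
  proof (rule bij_betw_byWitness[where f' = "\<lambda>p C s. p (C, s)"])
    show "(\<lambda>P. \<lambda>(C, s). P C s) ` empirical_models S
        \<subseteq> probabilistic_models (scenario_hypergraph S)"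
      using iff[of "\<lambda>(C, s). P C s" P for P]
      by (auto simp: empirical_models_def probabilistic_models_def vertices)
    show "(\<lambda>p C s. p (C, s)) ` probabilistic_models (scenario_hypergraph S)
        \<subseteq> empirical_models S"
      using iff[of p "\<lambda>C s. p (C, s)" for p]
      by (auto simp: empirical_models_def probabilistic_models_def vertices)
  qed auto
qed

end
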